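(* Let $F\in C^{0}(\mathbb{R}^n;\mathbb{R}^n)$ be a complete vector field giving rise to $\dot{x}=F(x)$, and let $A\subseteq\mathbb{R}^n$ be a nonempty compact convex set that is globally asymptotically stable (GAS) under $F$. If there is a convex $C^{\infty}$ Lyapunov function $V$ asserting that $A$ is GAS, then $F$ is straight-line homotopic to $\Pi_A-\mathrm{id}_{\mathbb{R}^n}$ on $\mathbb{R}^n\setminus A$ such that $A$ is GAS throughout the homotopy; that is, for every $s\in[0,1]$ the set $A$ is GAS under the vector field on $\mathbb{R}^n\setminus A$ given by $x\mapsto H(s,x):=(1-s)F(x)+s\,(\Pi_A(x)-x)$.
   Context: A continuous vector field $F$ on $\mathbb{R}^n$ is complete if it induces a continuous global flow $\varphi:\mathbb{R}\times\mathbb{R}^n\to\mathbb{R}^n$. The projection onto $A$ is $\Pi_A(x):=\arg\min_{y\in A}\|x-y\|_2$, which is single-valued for $A$ nonempty, compact and convex. The compact set $A$ is GAS under $F$ if it is invariant ($\varphi(\mathbb{R},A)=A$), Lyapunov stable (for every open $U_\varepsilon\supseteq A$ there is an open $U_\delta$ with $A\subseteq U_\delta\subseteq U_\varepsilon$ such that solutions starting in $U_\delta$ stay in $U_\varepsilon$ for all forward times) and globally attractive ($\mathrm{dist}(\varphi^t(x_0),A)\to 0$ as $t\to+\infty$ for all $x_0\in\mathbb{R}^n$). For a continuous vector field $G$ defined only on $\mathbb{R}^n\setminus A$, nothing is asserted about the dynamics on $A$, and "$A$ is GAS under $G$" means: (i) for every open $U_\varepsilon\supseteq A$ there is an open $U_\delta$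 with $A\subseteq U_\delta\subseteq U_\varepsilon$ such that every solution of $\dot x=G(x)$ in $\mathbb{R}^n\setminus A$ starting in $U_\delta\setminus A$ stays in $U_\varepsilon$ for as long (forward in time) as it is defined; and (ii) every maximal forward solution $x:[0,T)\to\mathbb{R}^n\setminus A$ of $\dot x=G(x)$, $T\in(0,+\infty]$, satisfies $\mathrm{dist}(x(t),A)\to 0$ as $t\to T$. A $C^\infty$ Lyapunov function with respect to $F$ and $A$ is a function $V\in C^\infty(\mathbb{R}^n;\mathbb{R}_{\geq 0})$ with (a) $V(x)=0\iff x\in A$; (b) $\langle\nabla V(x),F(x)\rangle<0$ for all $x\in\mathbb{R}^n\setminus A$; (c) $V(x)\to+\infty$ as $\|x\|\to+\infty$. *)

theory Defs
  imports "HOL-Analysis.Analysis"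
begin

primrec C_k :: "nat \<Rightarrow> (real ^ 'n \<Rightarrow> real) \<Rightarrow> bool" where
  "C_k 0 f \<longleftrightarrow> continuous_on UNIV f"
| "C_k (Suc k) f \<longleftrightarrow>
     (\<forall>x. f differentiable (at x)) \<and>
     (\<forall>i. C_k k (\<lambda>x. frechet_derivative f (at x) (axis i 1)))"

definition C_infinity :: "(real ^ 'n \<Rightarrow> real) \<Rightarrow> bool" where
  "C_infinity f \<longleftrightarrow> (\<forall>k. C_k k f)"

definition gradient :: "(real ^ 'n \<Rightarrow> real) \<Rightarrow> real ^ 'n \<Rightarrow> real ^ 'n" where
  "gradient f x = (\<chi> i. frechet_derivative f (at x) (axis i 1))"

text \<open>
  A vector field is complete if it induces some continuous global flow. As the vector field
  is only assumed continuous, uniqueness of solutions is not part of the definition.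
\<close>
definition induces_flow :: "(real ^ 'n \<Rightarrow> real ^ 'n) \<Rightarrow> (real \<times> (real ^ 'n) \<Rightarrow> real ^ 'n) \<Rightarrow> bool" where
  "induces_flow F \<phi> \<longleftrightarrow>
     continuous_on UNIV \<phi> \<and>
     (\<forall>x. \<phi> (0, x) = x) \<and>
     (\<forall>s t x. \<phi> (s + t, x) = \<phi> (s, \<phi> (t, x))) \<and>
     (\<forall>t x. ((\<lambda>\<tau>. \<phi> (\<tau>, x)) has_vector_derivative F (\<phi> (t, x))) (at t))"

definition GAS_flow :: "(real \<times> (real ^ 'n) \<Rightarrow> real ^ 'n) \<Rightarrow> (real ^ 'n) set \<Rightarrow> bool" where
  "GAS_flow \<phi> A \<longleftrightarrow>
     \<phi> ` (UNIV \<times> A) = A \<and>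
     (\<forall>U. open U \<and> A \<subseteq> U \<longrightarrow>
        (\<exists>W. open W \<and> A \<subseteq> W \<and> W \<subseteq> U \<and> (\<forall>x\<in>W. \<forall>t\<ge>0. \<phi> (t, x) \<in> U))) \<and>
     (\<forall>x. ((\<lambda>t. infdist (\<phi> (t, x)) A) \<longlongrightarrow> 0) at_top)"

text \<open>
  Solutions of \<open>x' = G x\<close> on the interval \<open>J\<close> that remain in the domain \<open>D\<close> of the vector field;
  values of \<open>G\<close> outside \<open>D\<close> are irrelevant. At an endpoint of \<open>J\<close> the derivative is one-sided.
\<close>
definition solves_in :: "(real ^ 'n \<Rightarrow> real ^ 'n) \<Rightarrow> (real ^ 'n) set \<Rightarrow> real set \<Rightarrow> (real \<Rightarrow> real ^ 'n) \<Rightarrow> bool"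
  where
  "solves_in G D J x \<longleftrightarrow>
     is_interval J \<and>
     (\<forall>t\<in>J. x t \<in> D \<and> (x has_vector_derivative G (x t)) (at t within J))"

definition forward_interval :: "ereal \<Rightarrow> real set" where
  "forward_interval T = {t. 0 \<le> t \<and> ereal t < T}"

definition maximal_forward_solution ::
  "(real ^ 'n \<Rightarrow> real ^ 'n) \<Rightarrow> (real ^ 'n) set \<Rightarrow> ereal \<Rightarrow> (real \<Rightarrow> real ^ 'n) \<Rightarrow> bool" where
  "maximal_forward_solution G D T x \<longleftrightarrow>
     0 < T \<and> solves_in G D (forward_interval T) x \<and>
     \<not> (\<exists>T' y. T < T' \<and> solves_in G D (forward_interval T') y \<and>
               (\<forall>t\<in>forward_interval T. y t = x t))"

text \<open>
  Global asymptotic stability of \<open>A\<close> under a vector field defined only on the complement of \<open>A\<close>.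
  Composing with \<^const>\<open>real_of_ereal\<close> and taking the left limit at the extended real \<open>T\<close> covers
  \<open>t \<rightarrow> T\<close> for finite and infinite \<open>T\<close> alike (cf. \<open>ereal_tendsto_simps\<close>).
\<close>
definition GAS_off :: "(real ^ 'n \<Rightarrow> real ^ 'n) \<Rightarrow> (real ^ 'n) set \<Rightarrow> bool" where
  "GAS_off G A \<longleftrightarrow>
     (\<forall>U. open U \<and> A \<subseteq> U \<longrightarrow>
        (\<exists>W. open W \<and> A \<subseteq> W \<and> W \<subseteq> U \<and>
           (\<forall>J x. solves_in G (- A) J x \<and> 0 \<in> J \<and> x 0 \<in> W - A \<longrightarrow>
              (\<forall>t\<in>J. 0 \<le> t \<longrightarrow> x t \<in> U)))) \<and>
     (\<forall>T x. maximal_forward_solution G (- A) T x \<longrightarrow>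
        (((\<lambda>t. infdist (x t) A) \<circ> real_of_ereal) \<longlongrightarrow> 0) (at_left T))"

definition lyapunov_function ::
  "(real ^ 'n \<Rightarrow> real ^ 'n) \<Rightarrow> (real ^ 'n) set \<Rightarrow> (real ^ 'n \<Rightarrow> real) \<Rightarrow> bool" where
  "lyapunov_function F A V \<longleftrightarrow>
     C_infinity V \<and> (\<forall>x. 0 \<le> V x) \<and>
     (\<forall>x. V x = 0 \<longleftrightarrow> x \<in> A) \<and>
     (\<forall>x. x \<notin> A \<longrightarrow> gradient V x \<bullet> F x < 0) \<and>
     filterlim V at_top at_infinity"

end

theory Submission
  imports Defs "HOL-Complex_Analysis.Great_Picard"
begin

text \<open>
  Convexity gives \<open>\<langle>\<nabla>V x, p - x\<rangle> \<le> V p - V x\<close>; at the projection \<open>p\<close> of \<open>x \<notin> A\<close> onto \<open>A\<close> the right-hand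
  side is \<open>- V x < 0\<close>. So \<open>V\<close> strictly decreases along both ends of the homotopy, hence along every
  convex combination of them. A strict coercive Lyapunov function yields stability through its
  sublevel sets. For attraction, a solution on which \<open>V\<close> stays above some \<open>c > 0\<close> remains in a compact
  subset of the complement of \<open>A\<close>: there \<open>V\<close> decreases at a rate bounded away from 0, which is
  impossible for all times, and a solution of finite life span could be continued by Peano's
  theorem, contradicting maximality.
\<close>

section \<open>Peano's existence theorem\<close>

text \<open>With a delay, the values of \<open>z\<close> on [0, n\<delta>] already determine the
  integral up to time (n+1)\<delta>. Picard iteration from the constant \<open>p\<close> therefore
  produces an exact solution on the unit interval after finitely many steps.\<close>

lemma delayed_integral_equation_solution:
  fixes g :: "'a::euclidean_space \<Rightarrow> 'a"
  assumes g: "continuous_on UNIV g" and \<delta>: "0 < \<delta>"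
  shows "\<exists>z. continuous_on {0..1} z \<and>
    (\<forall>t\<in>{0..1::real}. z t = p + integral {0..t} (\<lambda>s. g (z (max 0 (s - \<delta>)))))"
proof -
  define T where "T = (\<lambda>y t. p + integral {0..t} (\<lambda>s. g (y (max 0 (s - \<delta>)))))"
  define Y where "Y n = (T ^^ n) (\<lambda>_. p)" for n
  have Y_Suc: "Y (Suc n) = T (Y n)" for n
    by (simp add: Y_def)
  have delay_cont: "continuous_on {0..1} (\<lambda>s. g (y (max 0 (s - \<delta>))))"
    if "continuous_on {0..1} y" for y :: "real \<Rightarrow> 'a"
    by (rule continuous_on_compose2[OF g], rule continuous_on_compose2[OF that])
       (use \<delta> in \<open>auto intro!: continuous_intros\<close>)
  have cont: "continuous_on {0..1} (Y n)" for n
  proof (induction n)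
    case 0
    then show ?case by (simp add: Y_def)
  next
    case (Suc n)
    show ?case
      unfolding Y_Suc T_def
      by (intro continuous_intros indefinite_integral_continuous_1 integrable_continuous_real
          delay_cont Suc)
  qed
  \<comment> \<open>The delay makes the iteration stationary on \<open>[0, n * \<delta>]\<close> after \<open>n\<close> steps.\<close>
  have fixed: "\<forall>t\<in>{0..1}. t \<le> n * \<delta> \<longrightarrow> Y (Suc n) t = Y n t" for n :: nat
  proof (induction n)
    case 0
    then show ?case by (auto simp: Y_def T_def)
  next
    case (Suc n)
    have "Y (Suc (Suc n)) t = Y (Suc n) t" if t: "t \<in> {0..1}" "t \<le> Suc n * \<delta>" for t
    proof -
      have "Y (Suc n) (max 0 (s - \<delta>)) = Y n (max 0 (s - \<delta>))" if "s \<in> {0..t}" for s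
      proof -
        have "max 0 (s - \<delta>) \<in> {0..1}" using that t \<delta> by auto
        moreover have "max 0 (s - \<delta>) \<le> n * \<delta>" using that t \<delta> by (auto simp: algebra_simps)
        ultimately show ?thesis using Suc by blast
      qed
      then have "integral {0..t} (\<lambda>s. g (Y (Suc n) (max 0 (s - \<delta>))))
        = integral {0..t} (\<lambda>s. g (Y n (max 0 (s - \<delta>))))"
        by (intro integral_cong) auto
      then show ?thesis unfolding Y_Suc[of "Suc n"] Y_Suc[of n] T_def by simp
    qed
    then show ?case by blast
  qed
  \<comment> \<open>After \<open>N\<close> steps with N\<delta> \<ge> 1 the stationary range covers
    all of [0, 1], so \<open>Y N\<close> is a fixed point of \<open>T\<close> there.\<close>
  obtain N :: nat where "1 / \<delta> < N" using reals_Archimedean2 by blast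
  then have "1 \<le> N * \<delta>" using \<delta> by (simp add: field_simps)
  then have "\<forall>t\<in>{0..1}. Y N t = T (Y N) t"
    using fixed[of N] unfolding Y_Suc by force
  then show ?thesis
    using cont[of N] unfolding T_def by blast
qed

text \<open>The bound \<open>M\<close> makes all delayed solutions Lipschitz with the same constant.
  Arzela-Ascoli extracts a uniform limit as the delay tends to 0, and dominated convergence with
  majorant \<open>M\<close> carries the integral equation over to the limit. Boundedness also keeps
  the time interval fixed at [0, 1].\<close>

lemma peano_bounded:
  fixes g :: "'a::euclidean_space \<Rightarrow> 'a"
  assumes g: "continuous_on UNIV g" and M: "\<And>x. norm (g x) \<le> M"
  shows "\<exists>w. w 0 = p \<and>
    (\<forall>t\<in>{0..1::real}. (w has_vector_derivative g (w t)) (at t within {0..1}))"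
proof -
  have M0: "0 \<le> M" using M[of 0] norm_ge_zero order_trans by blast
  define d where "d n = 1 / real (Suc n)" for n
  have d0: "0 < d n" for n by (simp add: d_def)
  have "\<forall>n. \<exists>z. continuous_on {0..1} z \<and>
    (\<forall>t\<in>{0..1::real}. z t = p + integral {0..t} (\<lambda>s. g (z (max 0 (s - d n)))))"
    using delayed_integral_equation_solution[OF g d0] by blast
  then obtain Z where Zc: "\<And>n. continuous_on {0..1} (Z n)"
    and Z: "\<And>n t. t \<in> {0..1::real} \<Longrightarrow> Z n t = p + integral {0..t} (\<lambda>s. g (Z n (max 0 (s - d n))))"
    by metis
  have delay_cont: "continuous_on {0..1} (\<lambda>s. g (Z n (max 0 (s - d n))))" for n
    by (rule continuous_on_compose2[OF g], rule continuous_on_compose2[OF Zc[of n]])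
       (use d0[of n] in \<open>auto intro!: continuous_intros\<close>)
  have lip_le: "norm (Z n t - Z n s) \<le> M * (t - s)" if "s \<le> t" "s \<in> {0..1}" "t \<in> {0..1}" for n s t
  proof -
    let ?f = "\<lambda>s. g (Z n (max 0 (s - d n)))"
    have "integral {0..s} ?f + integral {s..t} ?f = integral {0..t} ?f"
      using that
      by (intro Henstock_Kurzweil_Integration.integral_combine integrable_continuous_real
          continuous_on_subset[OF delay_cont[of n]]) auto
    then have "Z n t - Z n s = integral {s..t} ?f"
      using Z[of t n] Z[of s n] that by (simp add: algebra_simps)
    moreover have "norm (integral {s..t} ?f) \<le> M * (t - s)"
      using that M by (intro integral_bound continuous_on_subset[OF delay_cont[of n]]) auto
    ultimately show ?thesis by simp
  qed
  have lip: "norm (Z n s - Z n t) \<le> M * \<bar>s - t\<bar>" if "s \<in> {0..1}" "t \<in> {0..1}" for n s t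
    using lip_le[of s t n] lip_le[of t s n] that by (cases "s \<le> t") (auto simp: norm_minus_commute)
  have Z0: "Z n 0 = p" for n using Z[of 0 n] by simp
  \<comment> \<open>Tonelli's approximations: solutions with vanishing delay are equi-Lipschitz.\<close>
  obtain w and k :: "nat \<Rightarrow> nat" where wc: "continuous_on {0..1} w" and k: "strict_mono k"
    and conv: "\<And>e. 0 < e \<Longrightarrow> \<exists>N. \<forall>n x. n \<ge> N \<and> x \<in> {0..1} \<longrightarrow> norm (Z (k n) x - w x) < e"
  proof (rule Arzela_Ascoli[of "{0..1::real}" Z "norm p + M"])
    show "norm (Z n x) \<le> norm p + M" if "x \<in> {0..1}" for n x
    proof -
      have "norm (Z n x - p) \<le> M * \<bar>x - 0\<bar>" using lip[of x 0 n] that Z0 by simp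
      also have "\<dots> \<le> M" using that M0 by (simp add: mult_left_le)
      finally show ?thesis using norm_triangle_sub[of "Z n x" p] by simp
    qed
    show "\<exists>d>0. \<forall>n y. y \<in> {0..1} \<and> norm (x - y) < d \<longrightarrow> norm (Z n x - Z n y) < e"
      if "x \<in> {0..1}" "0 < e" for x e
    \<comment> \<open>Dividing by \<open>M + 1\<close> instead of \<open>M\<close> covers the case
      \<open>M = 0\<close>.\<close>
    proof (intro exI[of _ "e / (M + 1)"] conjI allI impI)
      show "0 < e / (M + 1)" using that M0 by simp
      fix n y assume y: "y \<in> {0..1} \<and> norm (x - y) < e / (M + 1)"
      have "norm (Z n x - Z n y) \<le> M * \<bar>x - y\<bar>" using lip that y by blast
      also have "\<dots> \<le> (M + 1) * \<bar>x - y\<bar>" by (simp add: mult_right_mono)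
      also have "\<dots> < e" using y M0 by (simp add: field_simps)
      finally show "norm (Z n x - Z n y) < e" .
    qed
  qed auto
  have Zw: "(\<lambda>n. Z (k n) x) \<longlonglongrightarrow> w x" if "x \<in> {0..1}" for x
    unfolding LIMSEQ_iff using conv that by blast
  have dk: "(\<lambda>n. d (k n)) \<longlonglongrightarrow> 0"
    using LIMSEQ_subseq_LIMSEQ[OF LIMSEQ_inverse_real_of_nat k]
    by (simp add: d_def o_def inverse_eq_divide)
  \<comment> \<open>The delayed argument is within \<open>d (k n)\<close> of \<open>s\<close>, so
    the common Lipschitz constant bounds the error by \<open>M * d (k n)\<close>, which tends to
    0.\<close>
  have Zdw: "(\<lambda>n. Z (k n) (max 0 (s - d (k n)))) \<longlonglongrightarrow> w s" if s: "s \<in> {0..1}" for s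
  proof -
    have "(\<lambda>n. Z (k n) (max 0 (s - d (k n))) - Z (k n) s) \<longlonglongrightarrow> 0"
    proof (rule Lim_null_comparison)
      show "\<forall>\<^sub>F n in sequentially. norm (Z (k n) (max 0 (s - d (k n))) - Z (k n) s) \<le> M * d (k n)"
      proof (intro always_eventually allI)
        fix n
        have "norm (Z (k n) (max 0 (s - d (k n))) - Z (k n) s) \<le> M * \<bar>max 0 (s - d (k n)) - s\<bar>"
          using s d0[of "k n"] by (intro lip) auto
        also have "\<dots> \<le> M * d (k n)"
          using s d0[of "k n"] M0 by (intro mult_left_mono) auto
        finally show "norm (Z (k n) (max 0 (s - d (k n))) - Z (k n) s) \<le> M * d (k n)" .
      qed
      show "(\<lambda>n. M * d (k n)) \<longlonglongrightarrow> 0"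
        using tendsto_mult_left[OF dk, of M] by simp
    qed
    from tendsto_add[OF this Zw[OF s]] show ?thesis by simp
  qed
  have weq: "w t = p + integral {0..t} (\<lambda>s. g (w s))" if t: "t \<in> {0..1}" for t
  proof -
    have "(\<lambda>n. integral {0..t} (\<lambda>s. g (Z (k n) (max 0 (s - d (k n))))))
      \<longlonglongrightarrow> integral {0..t} (\<lambda>s. g (w s))"
    proof (rule dominated_convergence(2)[where h = "\<lambda>_. M"])
      show "(\<lambda>s. g (Z (k n) (max 0 (s - d (k n))))) integrable_on {0..t}" for n
        using t by (intro integrable_continuous_real continuous_on_subset[OF delay_cont]) auto
      show "(\<lambda>n. g (Z (k n) (max 0 (s - d (k n))))) \<longlonglongrightarrow> g (w s)" if "s \<in> {0..t}" for s
        using continuous_on_tendsto_compose[OF g Zdw[of s]] that t by auto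
    qed (use M in auto)
    then have "(\<lambda>n. Z (k n) t) \<longlonglongrightarrow> p + integral {0..t} (\<lambda>s. g (w s))"
      unfolding Z[OF t] by (intro tendsto_intros)
    then show ?thesis using Zw[OF t] LIMSEQ_unique by blast
  qed
  have gw: "continuous_on {0..1} (\<lambda>s. g (w s))"
    using continuous_on_compose2[OF g wc] by simp
  have "(w has_vector_derivative g (w t)) (at t within {0..1})" if t: "t \<in> {0..1}" for t
  proof -
    have "((\<lambda>t. p + integral {0..t} (\<lambda>s. g (w s))) has_vector_derivative g (w t)) (at t within {0..1})"
      using integral_has_vector_derivative[OF gw t] by (auto intro!: derivative_eq_intros)
    then show ?thesis
      by (rule has_vector_derivative_transform[rotated 2]) (use t weq in auto)
  qed
  moreover have "w 0 = p" using weq[of 0] by simp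
  ultimately show ?thesis by blast
qed

text \<open>Composing \<open>G\<close> with the projection onto a closed ball inside
  \<open>D\<close> gives a bounded continuous field on the whole space. Its solution solves the
  original equation while it stays in the ball, which by continuity it does for a short
  time.\<close>

lemma peano_local:
  fixes G :: "'a::euclidean_space \<Rightarrow> 'a"
  assumes D: "open D" "p \<in> D" and G: "continuous_on D G"
  shows "\<exists>\<epsilon>>0. \<exists>w. w 0 = p \<and>
    (\<forall>t\<in>{0..\<epsilon>::real}. w t \<in> D \<and> (w has_vector_derivative G (w t)) (at t within {0..\<epsilon>}))"
proof -
  obtain r where r: "0 < r" "cball p r \<subseteq> D" using D open_contains_cball by blast
  let ?c = "closest_point (cball p r)"
  have cc: "continuous_on UNIV ?c" using r by (intro continuous_on_closest_point) auto
  have cin: "?c x \<in> cball p r" for x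
    using r by (intro closest_point_in_set) auto
  have Gr: "continuous_on (cball p r) G" using G r continuous_on_subset by blast
  have gc: "continuous_on UNIV (\<lambda>x. G (?c x))"
    using continuous_on_compose2[OF Gr cc] cin by blast
  obtain M where "\<forall>y\<in>G ` cball p r. norm y \<le> M"
    using compact_imp_bounded[OF compact_continuous_image[OF Gr compact_cball]]
    unfolding bounded_iff by blast
  then have "norm (G (?c x)) \<le> M" for x using cin by blast
  from peano_bounded[OF gc this, of p] obtain w where w0: "w 0 = p"
    and w: "\<And>t. t \<in> {0..1::real} \<Longrightarrow> (w has_vector_derivative G (?c (w t))) (at t within {0..1})"
    by blast
  have wc: "continuous_on {0..1} w"
    using w by (intro continuous_on_vector_derivative) blast
  then obtain \<delta> where \<delta>: "\<delta> > 0" "\<And>t. t \<in> {0..1} \<Longrightarrow> dist t 0 < \<delta> \<Longrightarrow> dist (w t) (w 0) < r"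
    using r unfolding continuous_on_iff by (metis atLeastAtMost_iff order_refl zero_le_one)
  \<comment> \<open>Halving \<delta> gives \<epsilon> < \<delta>, so that the strict distance
    condition also holds at the right endpoint of the closed interval.\<close>
  define \<epsilon> where "\<epsilon> = min 1 (\<delta> / 2)"
  have \<epsilon>: "0 < \<epsilon>" "\<epsilon> \<le> 1" "\<epsilon> < \<delta>" using \<delta> by (auto simp: \<epsilon>_def)
  have "w t \<in> D \<and> (w has_vector_derivative G (w t)) (at t within {0..\<epsilon>})" if t: "t \<in> {0..\<epsilon>}" for t
  proof -
    have "w t \<in> cball p r" using \<delta>(2)[of t] t \<epsilon> w0 by (auto simp: dist_commute)
    moreover from this have "?c (w t) = w t" by (rule closest_point_self)
    ultimately show ?thesis
      using w[of t] t \<epsilon> r by (auto intro: has_vector_derivative_within_subset)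
  qed
  then show ?thesis using \<epsilon> w0 by blast
qed

text \<open>The fundamental theorem of calculus tolerates finitely many exceptional points, so
  \<open>y\<close> is an indefinite integral of the continuous \<open>f\<close> and is
  differentiable at those points and at the endpoints too. This serves to glue two solutions at
  their junction.\<close>

lemma has_vector_derivative_of_finite_exceptions:
  fixes y :: "real \<Rightarrow> 'a::euclidean_space"
  assumes "finite S" and f: "continuous_on {a..b} f" and y: "continuous_on {a..b} y"
    and deriv: "\<And>t. t \<in> {a<..<b} - S \<Longrightarrow> (y has_vector_derivative f t) (at t)"
    and t: "t \<in> {a..b}"
  shows "(y has_vector_derivative f t) (at t within {a..b})"
proof -
  have eq: "y u = y a + integral {a..u} f" if "u \<in> {a..b}" for u
  proof -
    have "(f has_integral (y u - y a)) {a..u}"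
      using that assms(1) y deriv
      by (intro fundamental_theorem_of_calculus_interior_strong[of S])
         (auto intro: continuous_on_subset)
    then show ?thesis by (simp add: integral_unique)
  qed
  have "((\<lambda>u. y a + integral {a..u} f) has_vector_derivative f t) (at t within {a..b})"
    using integral_has_vector_derivative[OF f t] by (auto intro!: derivative_eq_intros)
  then show ?thesis
    by (rule has_vector_derivative_transform[rotated 2]) (use t in \<open>blast intro: eq\<close>)+
qed

text \<open>On \<open>K\<close> the velocity is bounded, so \<open>x\<close> is Lipschitz and has a
  limit at \<open>r\<close>. The limit lies in \<open>K\<close>, hence in \<open>D\<close>, where
  Peano's theorem starts a further piece of solution.\<close>

lemma solution_in_compact_extends:
  fixes G :: "real ^ 'n \<Rightarrow> real ^ 'n"
  assumes D: "open D" and G: "continuous_on D G" and r: "0 < r"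
    and x: "solves_in G D {0..<r} x"
    and K: "compact K" "K \<subseteq> D" "\<And>t. t \<in> {0..<r} \<Longrightarrow> x t \<in> K"
  shows "\<exists>b>r. \<exists>y. solves_in G D {0..<b} y \<and> (\<forall>t\<in>{0..<r}. y t = x t)"
proof -
  have xd: "(x has_vector_derivative G (x t)) (at t within {0..<r})" if "t \<in> {0..<r}" for t
    using x that by (auto simp: solves_in_def)
  obtain M where "\<forall>y\<in>G ` K. norm y \<le> M"
    using compact_imp_bounded[OF compact_continuous_image[OF continuous_on_subset[OF G K(2)] K(1)]]
    unfolding bounded_iff by blast
  then have M: "norm (G (x t)) \<le> M" if "t \<in> {0..<r}" for t
    using K(3) that by blast
  have "M-lipschitz_on {0..<r} x"
  proof (rule lipschitz_onI)
    show "dist (x s) (x t) \<le> M * dist s t" if "s \<in> {0..<r}" "t \<in> {0..<r}" for s t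
    proof -
      \<comment> \<open>The derivative of \<open>x\<close> at \<open>u\<close> is the linear map h
        \<mapsto> h G(x(u)); bounding its norm by \<open>M\<close> allows the mean value inequality
        on the interval.\<close>
      have "onorm (\<lambda>h. h *\<^sub>R G (x u)) \<le> M" if "u \<in> {0..<r}" for u
        using M[OF that] by (intro onorm_le) (simp add: mult.commute[of _ "norm (G (x u))"] mult_right_mono)
      then show ?thesis
        unfolding dist_norm
        using xd that by (intro differentiable_bound[where S = "{0..<r}" and f' = "\<lambda>u h. h *\<^sub>R G (x u)"])
          (auto simp: has_vector_derivative_def)
    qed
    show "0 \<le> M" using M[of 0] r norm_ge_zero order_trans by (metis atLeastLessThan_iff order_refl)
  qed
  then obtain h where "M-lipschitz_on (closure {0..<r}) h" and hx: "\<And>t. t \<in> {0..<r} \<Longrightarrow> h t = x t"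
    using lipschitz_extend_closure by blast
  then have hc: "continuous_on {0..r} h"
    using r lipschitz_on_continuous_on by (metis closure_atLeastLessThan)
  have hr: "h r \<in> K"
  proof -
    have "h ` closure {0..<r} \<subseteq> K"
      by (rule image_closure_subset) (use hc hx K r in \<open>auto simp: compact_imp_closed\<close>)
    then show ?thesis using r by auto
  qed
  then obtain \<epsilon> w where \<epsilon>: "0 < \<epsilon>" and w0: "w 0 = h r"
    and w: "\<And>t. t \<in> {0..\<epsilon>} \<Longrightarrow> w t \<in> D \<and> (w has_vector_derivative G (w t)) (at t within {0..\<epsilon>})"
    using peano_local[OF D _ G, of "h r"] K by blast
  have wc: "continuous_on {0..\<epsilon>} w"
    using w by (intro continuous_on_vector_derivative) blast
  define b where "b = r + \<epsilon>"
  \<comment> \<open>Both branches agree at \<open>t = r\<close> because \<open>w 0 = h r\<close>;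
    this gives continuity at the junction.\<close>
  define y where "y t = (if t \<le> r then h t else w (t - r))" for t
  have yx: "y t = x t" if "t \<in> {0..<r}" for t using that hx by (simp add: y_def)
  have yD: "y t \<in> D" if "t \<in> {0..b}" for t
    using that hx hr K w[of "t - r"] by (cases "t < r"; cases "t = r") (auto simp: y_def b_def)
  have "continuous_on ({0..r} \<union> {r..b}) y"
    unfolding y_def
  proof (rule continuous_on_If)
    show "continuous_on {r..b} (\<lambda>t. w (t - r))"
      by (rule continuous_on_compose2[OF wc]) (auto simp: b_def intro!: continuous_intros)
  qed (use hc w0 in auto)
  moreover have "{0..r} \<union> {r..b} = {0..b}" using r \<epsilon> by (auto simp: b_def)
  ultimately have yc: "continuous_on {0..b} y" by simp
  have Gy: "continuous_on {0..b} (\<lambda>t. G (y t))"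
    using continuous_on_compose2[OF G yc] yD by blast
  \<comment> \<open>At \<open>r\<close> the two pieces only supply one-sided information, so that
    point is left out here and recovered as the single exceptional point.\<close>
  have deriv: "(y has_vector_derivative G (y t)) (at t)" if t: "t \<in> {0<..<b} - {r}" for t
  proof (cases "t < r")
    case True
    have "(x has_vector_derivative G (y t)) (at t)"
      using xd[of t] True t yx[of t] at_within_interior[of t "{0..<r}"] by auto
    then show ?thesis
      by (rule has_vector_derivative_transform_within_open[where S = "{0<..<r}"])
        (use True t yx in auto)
  next
    case False
    have "(w has_vector_derivative G (y t)) (at (t - r))"
      using w[of "t - r"] False t at_within_interior[of "t - r" "{0..\<epsilon>}"]
      by (auto simp: b_def y_def)
    moreover have "((\<lambda>t. t - r) has_vector_derivative 1) (at t)"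
      by (auto intro!: derivative_eq_intros)
    ultimately have "(w \<circ> (\<lambda>t. t - r) has_vector_derivative G (y t)) (at t)"
      using vector_diff_chain_at by fastforce
    then show ?thesis
      by (rule has_vector_derivative_transform_within_open[where S = "{r<..<b}"])
        (use False t in \<open>auto simp: y_def\<close>)
  qed
  have "(y has_vector_derivative G (y t)) (at t within {0..<b})" if "t \<in> {0..<b}" for t
    by (rule has_vector_derivative_within_subset
          [OF has_vector_derivative_of_finite_exceptions[where S = "{r}", OF _ Gy yc deriv]])
      (use that in auto)
  then have "solves_in G D {0..<b} y"
    using yD by (auto simp: solves_in_def is_interval_co)
  then show ?thesis using yx \<epsilon> by (intro exI[of _ b]) (auto simp: b_def)
qed

section \<open>Strict Lyapunov functions off a compact set\<close>

text \<open>The level \<open>C_k (Suc 0)\<close> supplies differentiability and continuous partial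
  derivatives. Expanding \<open>h\<close> in the standard basis and using linearity identifies the
  Frechet derivative with the inner product against the gradient.\<close>

lemma C_infinity_gradient:
  assumes "C_infinity V"
  shows C_infinity_has_derivative_gradient: "(V has_derivative (\<lambda>h. gradient V x \<bullet> h)) (at x)"
    and C_infinity_continuous_gradient: "continuous_on UNIV (gradient V)"
proof -
  have "C_k (Suc 0) V" using assms unfolding C_infinity_def by blast
  then have diff: "V differentiable (at x)"
    and cont: "continuous_on UNIV (\<lambda>x. frechet_derivative V (at x) (axis i 1))" for x i
    by auto
  have L: "(V has_derivative frechet_derivative V (at x)) (at x)"
    using diff frechet_derivative_works by blast
  then interpret bounded_linear "frechet_derivative V (at x)" by (rule has_derivative_bounded_linear)
  have "frechet_derivative V (at x) h = gradient V x \<bullet> h" for h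
  proof -
    have "frechet_derivative V (at x) h
      = frechet_derivative V (at x) (\<Sum>i\<in>UNIV. (h $ i) *\<^sub>R axis i 1)"
      by (metis basis_expansion scalar_mult_eq_scaleR[abs_def])
    also have "\<dots> = gradient V x \<bullet> h"
      by (simp add: sum scaleR inner_vec_def gradient_def mult.commute)
    finally show ?thesis .
  qed
  then show "(V has_derivative (\<lambda>h. gradient V x \<bullet> h)) (at x)" using L by presburger
  show "continuous_on UNIV (gradient V)"
    unfolding gradient_def[abs_def] using cont by (intro continuous_on_vec_lambda)
qed

lemma compact_sublevel_of_coercive:
  fixes V :: "'a::euclidean_space \<Rightarrow> real"
  assumes "continuous_on UNIV V" "filterlim V at_top at_infinity"
  shows "compact {x. V x \<le> c}"
proof -
  obtain b where b: "\<And>x. norm x \<ge> b \<Longrightarrow> V x > c"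
    using assms(2) unfolding filterlim_at_top_dense eventually_at_infinity by blast
  have "bounded {x. V x \<le> c}"
    unfolding bounded_iff using b by (intro exI[of _ b]) (force simp: not_le[symmetric])
  moreover have "closed {x. V x \<le> c}"
    using assms(1) by (intro closed_Collect_le continuous_intros)
  ultimately show ?thesis by (simp add: compact_eq_bounded_closed)
qed

text \<open>\<open>V\<close> has a positive minimum on the compact set of points outside
  \<open>U\<close> with V \<le> 1. Any level below both this minimum and 1 is too low to be reached
  outside \<open>U\<close>.\<close>

lemma sublevel_subset_neighbourhood:
  fixes V :: "'a::euclidean_space \<Rightarrow> real"
  assumes V: "continuous_on UNIV V" "filterlim V at_top at_infinity" "\<And>x. x \<notin> A \<Longrightarrow> 0 < V x"
    and U: "open U" "A \<subseteq> U"
  shows "\<exists>c>0. {x. V x < c} \<subseteq> U"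
proof -
  let ?K = "{x. V x \<le> 1} - U"
  have K: "compact ?K" using compact_sublevel_of_coercive[OF V(1,2)] U compact_diff by blast
  show ?thesis
  proof (cases "?K = {}")
    case True
    then show ?thesis by (intro exI[of _ 1]) auto
  next
    case False
    obtain z where "z \<in> ?K" and z: "\<And>y. y \<in> ?K \<Longrightarrow> V z \<le> V y"
      using continuous_attains_inf[OF K False continuous_on_subset[OF V(1)]] by auto
    then have "0 < V z" using V U by blast
    then show ?thesis using z by (intro exI[of _ "min 1 (V z)"]) force
  qed
qed

text \<open>Mean value theorem for \<open>V\<close> along the solution, with the chain rule. The
  case \<open>m = 0\<close> gives monotonicity, a positive \<open>m\<close> gives linear
  decay.\<close>

lemma solves_in_decrease:
  fixes G :: "real ^ 'n \<Rightarrow> real ^ 'n"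
  assumes dV: "\<And>x. (V has_derivative (\<lambda>h. g x \<bullet> h)) (at x)"
    and x: "solves_in G D J x"
    and m: "\<And>u. u \<in> J \<Longrightarrow> g (x u) \<bullet> G (x u) \<le> - m"
    and st: "s \<in> J" "t \<in> J" "s \<le> t"
  shows "V (x t) \<le> V (x s) - m * (t - s)"
proof (cases "s = t")
  case False
  then have "s < t" using st by simp
  have sub: "{s..t} \<subseteq> J"
    using x st mem_is_interval_1_I[of J s t] by (auto simp: solves_in_def)
  have "((\<lambda>u. V (x u)) has_derivative (\<lambda>h. g (x u) \<bullet> (h *\<^sub>R G (x u)))) (at u within {s..t})"
    if "s \<le> u" "u \<le> t" for u
  proof -
    have "(x has_vector_derivative G (x u)) (at u within {s..t})"
      using x that sub unfolding solves_in_def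
      by (intro has_vector_derivative_within_subset[OF _ sub]) auto
    then show ?thesis
      unfolding has_vector_derivative_def by (rule has_derivative_compose[OF _ dV])
  qed
  from mvt_simple[OF \<open>s < t\<close> this] obtain u where "u \<in> {s<..<t}"
    and "V (x t) - V (x s) = g (x u) \<bullet> ((t - s) *\<^sub>R G (x u))" by blast
  moreover have "(t - s) * (g (x u) \<bullet> G (x u)) \<le> (t - s) * (- m)"
    using m[OF subsetD[OF sub, of u]] \<open>u \<in> {s<..<t}\<close> \<open>s < t\<close> by (intro mult_left_mono) auto
  ultimately show ?thesis by (simp add: algebra_simps)
qed simp

text \<open>Attraction is reduced to \<open>small\<close>: once \<open>V\<close> has dropped below a
  level, monotonicity keeps it there. A solution may reach \<open>A\<close> in finite time and then
  leave the domain of \<open>G\<close>, so finite and infinite life spans are treated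
  separately.\<close>

lemma GAS_off_if_strict_lyapunov:
  fixes G :: "real ^ 'n \<Rightarrow> real ^ 'n"
  assumes A: "compact A" and G: "continuous_on (- A) G"
    and dV: "\<And>x. (V has_derivative (\<lambda>h. g x \<bullet> h)) (at x)" and g: "continuous_on UNIV g"
    and V0: "\<And>x. x \<in> A \<Longrightarrow> V x = 0" and Vpos: "\<And>x. x \<notin> A \<Longrightarrow> 0 < V x"
    and neg: "\<And>x. x \<notin> A \<Longrightarrow> g x \<bullet> G x < 0"
    and coercive: "filterlim V at_top at_infinity"
  shows "GAS_off G A"
proof -
  have Vc: "continuous_on UNIV V"
    using dV by (intro has_derivative_continuous_on) (auto intro: has_derivative_at_withinI)
  have mono: "V (x t) \<le> V (x s)"
    if x: "solves_in G (- A) J x" and "s \<in> J" "t \<in> J" "s \<le> t" for J x s t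
  proof -
    \<comment> \<open>Written with \<open>- 0\<close> to match \<open>solves_in_decrease\<close> at
      \<open>m = 0\<close>.\<close>
    have "g (x u) \<bullet> G (x u) \<le> - 0" if "u \<in> J" for u
      using neg[of "x u"] x that by (auto simp: solves_in_def less_imp_le)
    from solves_in_decrease[OF dV x this] that show ?thesis by force
  qed
  have nhd: "\<exists>c>0. {x. V x < c} \<subseteq> U" if "open U" "A \<subseteq> U" for U
    using sublevel_subset_neighbourhood[OF Vc coercive _ that] Vpos by blast
  show ?thesis
    unfolding GAS_off_def
  proof (intro conjI allI impI)
    fix U assume "open U \<and> A \<subseteq> U"
    then obtain c where c: "0 < c" "{x. V x < c} \<subseteq> U" using nhd by blast
    have "open {x. V x < c}" using Vc by (intro open_Collect_less continuous_intros)
    moreover have "A \<subseteq> {x. V x < c}" using V0 c by auto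
    moreover have "x t \<in> U"
      if "solves_in G (- A) J x \<and> 0 \<in> J \<and> x 0 \<in> {x. V x < c} - A" "t \<in> J" "0 \<le> t" for J x t
      using mono[of J x 0 t] that c by auto
    ultimately show "\<exists>W. open W \<and> A \<subseteq> W \<and> W \<subseteq> U \<and>
      (\<forall>J x. solves_in G (- A) J x \<and> 0 \<in> J \<and> x 0 \<in> W - A \<longrightarrow> (\<forall>t\<in>J. 0 \<le> t \<longrightarrow> x t \<in> U))"
      using c(2) by (intro exI[of _ "{x. V x < c}"]) blast
  next
    fix T x assume max: "maximal_forward_solution G (- A) T x"
    let ?J = "forward_interval T"
    have T: "0 < T" and x: "solves_in G (- A) ?J x"
      using max by (auto simp: maximal_forward_solution_def)
    have J0: "0 \<in> ?J" using T by (auto simp: forward_interval_def zero_ereal_def)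
    have small: "\<exists>t0\<in>?J. V (x t0) < c" if "0 < c" for c
    proof (rule ccontr)
      assume "\<not> (\<exists>t0\<in>?J. V (x t0) < c)"
      then have ge: "c \<le> V (x t)" if "t \<in> ?J" for t using that by force
      \<comment> \<open>A shell between two levels of \<open>V\<close>: the upper level is the
        initial value, which \<open>V\<close> never exceeds afterwards; the lower level c > 0 keeps
        \<open>K\<close> away from \<open>A\<close>.\<close>
      define K where "K = {y. V y \<le> V (x 0)} \<inter> {y. c \<le> V y}"
      have KA: "K \<subseteq> - A" using V0 \<open>0 < c\<close> by (auto simp: K_def)
      have K: "compact K"
        unfolding K_def using compact_sublevel_of_coercive[OF Vc coercive] Vc
        by (intro compact_Int_closed closed_Collect_le continuous_intros)
      have xK: "x t \<in> K" if "t \<in> ?J" for t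
        using ge[OF that] mono[OF x J0 that] that by (auto simp: K_def forward_interval_def)
      show False
      proof (cases T)
        case (real r)
        have Jr: "forward_interval (ereal b) = {0..<b}" for b
          by (auto simp: forward_interval_def)
        have "0 < r" using T real by simp
        \<comment> \<open>Confinement to the compact \<open>K\<close> lets the solution continue
          beyond \<open>r\<close>, against maximality.\<close>
        then obtain b y where "b > r" "solves_in G (- A) {0..<b} y" "\<forall>t\<in>{0..<r}. y t = x t"
          using solution_in_compact_extends[OF _ G _ _ K KA, of r x] x xK A
          unfolding real Jr by (auto simp: compact_imp_closed open_Compl)
        then have "T < ereal b \<and> solves_in G (- A) (forward_interval (ereal b)) y
          \<and> (\<forall>t\<in>forward_interval T. y t = x t)"
          unfolding real Jr by simp
        then show False using max unfolding maximal_forward_solution_def by blast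
      next
        case PInf
        have Jinf: "?J = {0..}" using PInf by (auto simp: forward_interval_def)
        have "continuous_on K (\<lambda>y. g y \<bullet> G y)"
          using KA by (intro continuous_intros continuous_on_subset[OF g] continuous_on_subset[OF G]) auto
        then obtain z where "z \<in> K" and z: "\<And>y. y \<in> K \<Longrightarrow> g y \<bullet> G y \<le> g z \<bullet> G z"
          using continuous_attains_sup[OF K] xK[OF J0] by blast
        define m where "m = - (g z \<bullet> G z)"
        have "0 < m" using neg \<open>z \<in> K\<close> KA by (auto simp: m_def)
        have "V (x t) \<le> V (x 0) - m * (t - 0)" if "0 \<le> t" for t
          using that z xK Jinf by (intro solves_in_decrease[OF dV x]) (auto simp: m_def)
        \<comment> \<open>The time at which the linear upper bound reaches 0, whereas
          \<open>V\<close> was assumed to stay at least c > 0.\<close>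
        from this[of "V (x 0) / m"] have "V (x (V (x 0) / m)) \<le> 0"
          using \<open>0 < m\<close> ge[OF J0] \<open>0 < c\<close> by simp
        moreover have "V (x 0) / m \<in> ?J" using \<open>0 < m\<close> ge[OF J0] \<open>0 < c\<close> Jinf by simp
        ultimately show False using ge \<open>0 < c\<close> by force
      qed (use T in simp)
    qed
    \<comment> \<open>Phrased inside \<open>?J\<close> so that the same statement yields the limit
      at a finite \<open>T\<close> and at infinity. The level \<open>c\<close> is chosen with its
      sublevel set inside the \<open>e\<close>-neighbourhood of \<open>A\<close>.\<close>
    have close: "\<exists>t0\<in>?J. \<forall>t\<in>?J. t0 \<le> t \<longrightarrow> dist (infdist (x t) A) 0 < e" if "0 < e" for e
    proof -
      have "open {y. infdist y A < e}"
        by (intro open_Collect_less continuous_intros)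
      moreover have "A \<subseteq> {y. infdist y A < e}" using \<open>0 < e\<close> by auto
      ultimately obtain c where c: "0 < c" "{y. V y < c} \<subseteq> {y. infdist y A < e}"
        using nhd by blast
      obtain t0 where t0: "t0 \<in> ?J" "V (x t0) < c" using small c by blast
      have "V (x t) < c" if "t \<in> ?J" "t0 \<le> t" for t
        using mono[OF x t0(1) that] t0 by simp
      then show ?thesis using t0 c by (intro bexI[of _ t0]) (auto simp: infdist_nonneg)
    qed
    show "(((\<lambda>t. infdist (x t) A) \<circ> real_of_ereal) \<longlongrightarrow> 0) (at_left T)"
    proof (cases T)
      case (real r)
      have "((\<lambda>t. infdist (x t) A) \<longlongrightarrow> 0) (at_left r)"
      proof (rule tendstoI)
        fix e :: real assume "0 < e"
        then obtain t0 where "t0 \<in> ?J" "\<forall>t\<in>?J. t0 \<le> t \<longrightarrow> dist (infdist (x t) A) 0 < e"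
          using close by blast
        then show "\<forall>\<^sub>F t in at_left r. dist (infdist (x t) A) 0 < e"
          unfolding real forward_interval_def by (intro eventually_at_leftI[of t0]) auto
      qed
      then show ?thesis by (simp add: real ereal_tendsto_simps)
    next
      case PInf
      have "((\<lambda>t. infdist (x t) A) \<longlongrightarrow> 0) at_top"
      proof (rule tendstoI)
        fix e :: real assume "0 < e"
        then obtain t0 where "t0 \<in> ?J" "\<forall>t\<in>?J. t0 \<le> t \<longrightarrow> dist (infdist (x t) A) 0 < e"
          using close by blast
        then show "\<forall>\<^sub>F t in at_top. dist (infdist (x t) A) 0 < e"
          unfolding PInf forward_interval_def eventually_at_top_linorder
          by (intro exI[of _ t0]) auto
      qed
      then show ?thesis by (simp add: PInf ereal_tendsto_simps)
    qed (use T in simp)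
  qed
qed

section \<open>The homotopy\<close>

text \<open>Restricted to the line through \<open>x\<close> and \<open>p\<close>, \<open>V\<close>
  is a convex function of one variable; it lies above its tangent at 0, and the inequality is read
  off at time 1.\<close>

lemma convex_on_above_tangent:
  fixes V :: "'a::real_normed_vector \<Rightarrow> real"
  assumes V: "convex_on UNIV V" and D: "(V has_derivative V') (at x)"
  shows "V' (p - x) \<le> V p - V x"
proof -
  let ?f = "\<lambda>t::real. V (x + t *\<^sub>R (p - x))"
  interpret bounded_linear V' using D by (rule has_derivative_bounded_linear)
  have "convex_on UNIV ?f"
  proof (rule convex_onI)
    fix t a b :: real assume "0 < t" "t < 1"
    have "x + ((1 - t) *\<^sub>R a + t *\<^sub>R b) *\<^sub>R (p - x)
      = (1 - t) *\<^sub>R (x + a *\<^sub>R (p - x)) + t *\<^sub>R (x + b *\<^sub>R (p - x))"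
      by (simp add: algebra_simps)
    then show "?f ((1 - t) *\<^sub>R a + t *\<^sub>R b) \<le> (1 - t) * ?f a + t * ?f b"
      using convex_onD[OF V, of t] \<open>0 < t\<close> \<open>t < 1\<close> by simp
  qed simp
  moreover have "(?f has_field_derivative V' (p - x)) (at 0)"
  proof -
    have "((\<lambda>t. x + t *\<^sub>R (p - x)) has_derivative (\<lambda>t. t *\<^sub>R (p - x))) (at 0)"
      by (auto intro!: derivative_eq_intros)
    from has_derivative_compose[OF this, of V V'] D show ?thesis
      by (simp add: has_field_derivative_def scaleR mult_commute_abs)
  qed
  ultimately show ?thesis
    using convex_on_imp_above_tangent[of UNIV ?f 0 1 "V' (p - x)"] by simp
qed

theorem mainTheorem4:
  fixes F :: "real ^ 'n \<Rightarrow> real ^ 'n"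
    and \<phi> :: "real \<times> (real ^ 'n) \<Rightarrow> real ^ 'n"
    and A :: "(real ^ 'n) set"
    and V :: "real ^ 'n \<Rightarrow> real"
  assumes "continuous_on UNIV F"
    and "induces_flow F \<phi>"
    and "A \<noteq> {}" and "compact A" and "convex A"
    and "GAS_flow \<phi> A"
    and "lyapunov_function F A V"
    and "convex_on UNIV V"
  shows "continuous_on ({0..1} \<times> (- A))
           (\<lambda>(s, x). (1 - s) *\<^sub>R F x + s *\<^sub>R (closest_point A x - x)) \<and>
         (\<forall>s\<in>{0..1}. GAS_off (\<lambda>x. (1 - s) *\<^sub>R F x + s *\<^sub>R (closest_point A x - x)) A)"
proof (intro conjI ballI)
  have "closed A" using \<open>compact A\<close> by (rule compact_imp_closed)
  have cp: "continuous_on S (closest_point A)" for S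
    using \<open>convex A\<close> \<open>closed A\<close> \<open>A \<noteq> {}\<close> by (rule continuous_on_closest_point)
  have F: "continuous_on S F" for S
    using \<open>continuous_on UNIV F\<close> continuous_on_subset by blast
  show "continuous_on ({0..1} \<times> (- A))
    (\<lambda>(s, x). (1 - s) *\<^sub>R F x + s *\<^sub>R (closest_point A x - x))"
    unfolding case_prod_unfold
    by (intro continuous_intros continuous_on_compose2[OF F] continuous_on_compose2[OF cp]) auto
  fix s :: real assume s: "s \<in> {0..1}"
  have V: "C_infinity V" "\<And>x. 0 \<le> V x" "\<And>x. V x = 0 \<longleftrightarrow> x \<in> A"
    "\<And>x. x \<notin> A \<Longrightarrow> gradient V x \<bullet> F x < 0" "filterlim V at_top at_infinity"
    using \<open>lyapunov_function F A V\<close> by (auto simp: lyapunov_function_def)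
  have Vpos: "0 < V x" if "x \<notin> A" for x
    using V(2,3)[of x] that by linarith
  show "GAS_off (\<lambda>x. (1 - s) *\<^sub>R F x + s *\<^sub>R (closest_point A x - x)) A"
  proof (rule GAS_off_if_strict_lyapunov[where V = V and g = "gradient V"])
    show "continuous_on (- A) (\<lambda>x. (1 - s) *\<^sub>R F x + s *\<^sub>R (closest_point A x - x))"
      by (intro continuous_intros F cp)
    show "gradient V x \<bullet> ((1 - s) *\<^sub>R F x + s *\<^sub>R (closest_point A x - x)) < 0" if x: "x \<notin> A" for x
    proof -
      have "V (closest_point A x) = 0"
        using closest_point_in_set[OF \<open>closed A\<close> \<open>A \<noteq> {}\<close>] V(3) by blast
      then have "gradient V x \<bullet> (closest_point A x - x) < 0"
        using convex_on_above_tangent[OF \<open>convex_on UNIV V\<close> C_infinity_has_derivative_gradient[OF V(1)],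
            of x "closest_point A x"] Vpos[OF x] by linarith
      \<comment> \<open>For \<open>s = 0\<close> strictness comes from the \<open>F\<close> term
        alone. For \<open>s > 0\<close> the projection term is strictly negative and the
        \<open>F\<close> term is at most 0, vanishing at \<open>s = 1\<close>.\<close>
      then have "(1 - s) * (gradient V x \<bullet> F x) + s * (gradient V x \<bullet> (closest_point A x - x)) < 0"
        using V(4)[OF x] s by (cases "s = 0")
          (auto intro!: add_nonpos_neg simp: mult_pos_neg mult_nonneg_nonpos)
      then show ?thesis by (simp add: inner_right_distrib)
    qed
  qed (use V Vpos \<open>compact A\<close> C_infinity_gradient[OF V(1)] in auto)
qed

end
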